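(* Let $\gamma:I\to M$ be a unit speed curve in a spacelike hypersurface $M\subset\mathbb{R}^4_1$ such that $k_g(s)\neq0$, $(k_n\tau_2+k_g\tau_g)(s)\neq0$ and $k_n^2(s)>k_g^2(s)$ for all $s\in I$. Let $H^S_t:I\times S^3_1\to\mathbb{R}$, $H^S_t(s,v)=\langle t(s),v\rangle$, be the family of spacelike tangential height functions of $\gamma$, and let $DS_\gamma:I\times[0,2\pi]\to S^3_1$, $$DS_\gamma(s,\theta)=\frac{\cos\theta}{\sqrt{k_n^2(s)-k_g^2(s)}}\bigl(k_g(s)n_\gamma(s)+k_n(s)n_1(s)\bigr)+\sin\theta\,n_2(s),$$ be the de Sitter surface of $\gamma$. Then the (image of the) de Sitter surface of $\gamma$ is the discriminant set of $H^S_t$, that is, $$DS_\gamma(I\times[0,2\pi])=\mathcal{D}_{H^S_t}=\Bigl\{v\in S^3_1\ \Big|\ \exists\,s\in I:\ H^S_t(s,v)=\frac{\partial H^S_t}{\partial s}(s,v)=0\Bigr\}.$$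
   Context: $\mathbb{R}^4_1$ is $\mathbb{R}^4$ with $\langle x,y\rangle=-x_0y_0+x_1y_1+x_2y_2+x_3y_3$; a nonzero vector $x$ is spacelike, lightlike or timelike if $\langle x,x\rangle$ is $>0$, $=0$ or $<0$; $\|x\|=\sqrt{|\langle x,x\rangle|}$. With $\{e_0,e_1,e_2,e_3\}$ the canonical basis, $x\wedge y\wedge z$ is the formal determinant with rows $(-e_0,e_1,e_2,e_3),x,y,z$. De Sitter space is $S^3_1=\{x\in\mathbb{R}^4_1\mid\langle x,x\rangle=1\}$. $U\subset\mathbb{R}^3$ is open, $X:U\to\mathbb{R}^4_1$ is a smooth embedding all of whose nonzero tangent vectors are spacelike, $M=X(U)$ (a spacelike hypersurface), and $n$ is the unit timelike normal field along $M$ which is future directed ($\langle n,e_0\rangle<0$). $I$ is an open interval and $\gamma=X\circ\bar\gamma:I\to M$, with $\bar\gamma:I\to U$ a smooth regular curve, is parametrized by arc length ("unit speed"). Put $t=\gamma'$, $n_\gamma(s)=n(\gamma(s))$, $k_n=-\langle n_\gamma,t'\rangle$, $k_g=\|t'-k_nn_\gamma\|$ and, when $k_g\ne0$ (so $k_g>0$), $n_1=(t'-k_nn_\gamma)/k_g$, $n_2=n_\gamma\wedge t\wedge n_1$, $\tau_1=\langle n_1,n_\gamma'\rangle$, $\tau_2=\langle n_2,n_\gamma'\rangle$, $\tau_g=-\langle n_2',n_1\rangle$. Then $\{n_\gamma,t,n_1,n_2\}$ is a pseudo-orthonormal frame along $\gamma$ with $n_\gamma'=k_nt+\tau_1n_1+\tau_2n_2$,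 $t'=k_nn_\gamma+k_gn_1$, $n_1'=\tau_1n_\gamma-k_gt+\tau_gn_2$, $n_2'=\tau_2n_\gamma-\tau_gn_1$. *)

theory Defs
  imports "HOL-Analysis.Analysis"
begin

text \<open>Iterated differentiability on an open set \<open>S\<close>: \<open>k\<close> successive directional derivatives
  exist as Frechet derivatives, and all of those of order \<open>k\<close> are continuous.\<close>

primrec C_k_on :: "nat \<Rightarrow> 'a::real_normed_vector set \<Rightarrow> ('a \<Rightarrow> 'b::real_normed_vector) \<Rightarrow> bool" where
  "C_k_on 0 S f \<longleftrightarrow> continuous_on S f"
| "C_k_on (Suc k) S f \<longleftrightarrow>
     (\<forall>x\<in>S. f differentiable (at x)) \<and>
     (\<forall>v. C_k_on k S (\<lambda>x. frechet_derivative f (at x) v))"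

definition smooth_on :: "'a::real_normed_vector set \<Rightarrow> ('a \<Rightarrow> 'b::real_normed_vector) \<Rightarrow> bool" where
  "smooth_on S f \<longleftrightarrow> (\<forall>k. C_k_on k S f)"

text \<open>The elements of the index type \<open>4\<close> are \<open>0, 1, 2, 3\<close> (and \<open>4 = 0\<close> in that type), so the
  components are numbered \<open>x $ 0, \<dots>, x $ 3\<close> with \<open>x $ 0\<close> the time component.\<close>

type_synonym R41 = "real ^ 4"

definition lprod :: "R41 \<Rightarrow> R41 \<Rightarrow> real" where
  "lprod x y = - (x $ 0) * (y $ 0) + x $ 1 * y $ 1 + x $ 2 * y $ 2 + x $ 3 * y $ 3"

definition spacelike :: "R41 \<Rightarrow> bool" where
  "spacelike x \<longleftrightarrow> x \<noteq> 0 \<and> lprod x x > 0"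

definition lnorm :: "R41 \<Rightarrow> real" where
  "lnorm x = sqrt \<bar>lprod x x\<bar>"

text \<open>The formal determinant with rows \<open>(-e\<^sub>0, e\<^sub>1, e\<^sub>2, e\<^sub>3)\<close>, \<open>x\<close>, \<open>y\<close>, \<open>z\<close>: its component along
  \<open>e\<^sub>i\<close> is the determinant whose first row has only the entry in column \<open>i\<close>, namely \<open>-1\<close> for
  \<open>i = 0\<close> and \<open>1\<close> otherwise.\<close>

definition wedge :: "R41 \<Rightarrow> R41 \<Rightarrow> R41 \<Rightarrow> R41" where
  "wedge x y z =
     (\<chi> i. det (\<chi> r. if r = 0 then axis i (if i = 0 then - 1 else 1)
                    else if r = 1 then x
                    else if r = 2 then y
                    else z))"

definition de_sitter :: "R41 set" where
  "de_sitter = {x. lprod x x = 1}"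

definition smooth_embedding :: "(real ^ 3 \<Rightarrow> R41) \<Rightarrow> (real ^ 3) set \<Rightarrow> bool" where
  "smooth_embedding X U \<longleftrightarrow>
     smooth_on U X \<and>
     (\<forall>u\<in>U. inj (frechet_derivative X (at u))) \<and>
     (\<exists>Y. homeomorphism U (X ` U) X Y)"

text \<open>The tangent space of \<open>X ` U\<close> at the point \<open>X u\<close>.\<close>

definition tangent_space :: "(real ^ 3 \<Rightarrow> R41) \<Rightarrow> real ^ 3 \<Rightarrow> R41 set" where
  "tangent_space X u = range (frechet_derivative X (at u))"

definition spacelike_hypersurface :: "(real ^ 3 \<Rightarrow> R41) \<Rightarrow> (real ^ 3) set \<Rightarrow> bool" where
  "spacelike_hypersurface X U \<longleftrightarrow>
     open U \<and> smooth_embedding X U \<and>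
     (\<forall>u\<in>U. \<forall>w\<in>tangent_space X u. w \<noteq> 0 \<longrightarrow> spacelike w)"

text \<open>These conditions determine \<open>n\<close> uniquely on \<open>X ` U\<close>, and hence also make it smooth there.\<close>

definition future_unit_normal :: "(real ^ 3 \<Rightarrow> R41) \<Rightarrow> (real ^ 3) set \<Rightarrow> (R41 \<Rightarrow> R41) \<Rightarrow> bool" where
  "future_unit_normal X U n \<longleftrightarrow>
     (\<forall>u\<in>U. lprod (n (X u)) (n (X u)) = - 1 \<and>
            (\<forall>w\<in>tangent_space X u. lprod (n (X u)) w = 0) \<and>
            lprod (n (X u)) (axis 0 1) < 0)"

definition regular_curve :: "real set \<Rightarrow> (real ^ 3) set \<Rightarrow> (real \<Rightarrow> real ^ 3) \<Rightarrow> bool" where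
  "regular_curve I U c \<longleftrightarrow>
     smooth_on I c \<and> c ` I \<subseteq> U \<and> (\<forall>s\<in>I. vector_derivative c (at s) \<noteq> 0)"

definition unit_speed :: "real set \<Rightarrow> (real \<Rightarrow> R41) \<Rightarrow> bool" where
  "unit_speed I \<gamma> \<longleftrightarrow> (\<forall>s\<in>I. lnorm (vector_derivative \<gamma> (at s)) = 1)"

text \<open>In the following, \<open>n\<close> is the normal field of the hypersurface and \<open>\<gamma>\<close> the curve in it.\<close>

definition tang :: "(real \<Rightarrow> R41) \<Rightarrow> real \<Rightarrow> R41" where
  "tang \<gamma> s = vector_derivative \<gamma> (at s)"

definition tang' :: "(real \<Rightarrow> R41) \<Rightarrow> real \<Rightarrow> R41" where
  "tang' \<gamma> s = vector_derivative (tang \<gamma>) (at s)"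

definition n_curve :: "(R41 \<Rightarrow> R41) \<Rightarrow> (real \<Rightarrow> R41) \<Rightarrow> real \<Rightarrow> R41" where
  "n_curve n \<gamma> s = n (\<gamma> s)"

definition k_n :: "(R41 \<Rightarrow> R41) \<Rightarrow> (real \<Rightarrow> R41) \<Rightarrow> real \<Rightarrow> real" where
  "k_n n \<gamma> s = - lprod (n_curve n \<gamma> s) (tang' \<gamma> s)"

definition k_g :: "(R41 \<Rightarrow> R41) \<Rightarrow> (real \<Rightarrow> R41) \<Rightarrow> real \<Rightarrow> real" where
  "k_g n \<gamma> s = lnorm (tang' \<gamma> s - k_n n \<gamma> s *\<^sub>R n_curve n \<gamma> s)"

definition n_1 :: "(R41 \<Rightarrow> R41) \<Rightarrow> (real \<Rightarrow> R41) \<Rightarrow> real \<Rightarrow> R41" where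
  "n_1 n \<gamma> s = (1 / k_g n \<gamma> s) *\<^sub>R (tang' \<gamma> s - k_n n \<gamma> s *\<^sub>R n_curve n \<gamma> s)"

definition n_2 :: "(R41 \<Rightarrow> R41) \<Rightarrow> (real \<Rightarrow> R41) \<Rightarrow> real \<Rightarrow> R41" where
  "n_2 n \<gamma> s = wedge (n_curve n \<gamma> s) (tang \<gamma> s) (n_1 n \<gamma> s)"

definition tau_2 :: "(R41 \<Rightarrow> R41) \<Rightarrow> (real \<Rightarrow> R41) \<Rightarrow> real \<Rightarrow> real" where
  "tau_2 n \<gamma> s = lprod (n_2 n \<gamma> s) (vector_derivative (n_curve n \<gamma>) (at s))"

definition tau_g :: "(R41 \<Rightarrow> R41) \<Rightarrow> (real \<Rightarrow> R41) \<Rightarrow> real \<Rightarrow> real" where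
  "tau_g n \<gamma> s = - lprod (vector_derivative (n_2 n \<gamma>) (at s)) (n_1 n \<gamma> s)"

definition height_St :: "(real \<Rightarrow> R41) \<Rightarrow> real \<Rightarrow> R41 \<Rightarrow> real" where
  "height_St \<gamma> s v = lprod (tang \<gamma> s) v"

definition discriminant_set :: "real set \<Rightarrow> 'a set \<Rightarrow> (real \<Rightarrow> 'a \<Rightarrow> real) \<Rightarrow> 'a set" where
  "discriminant_set I V F = {v\<in>V. \<exists>s\<in>I. F s v = 0 \<and> deriv (\<lambda>s. F s v) s = 0}"

definition DS :: "(R41 \<Rightarrow> R41) \<Rightarrow> (real \<Rightarrow> R41) \<Rightarrow> real \<Rightarrow> real \<Rightarrow> R41" where
  "DS n \<gamma> s \<theta> =
     (cos \<theta> / sqrt ((k_n n \<gamma> s)\<^sup>2 - (k_g n \<gamma> s)\<^sup>2)) *\<^sub>R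
       (k_g n \<gamma> s *\<^sub>R n_curve n \<gamma> s + k_n n \<gamma> s *\<^sub>R n_1 n \<gamma> s)
     + sin \<theta> *\<^sub>R n_2 n \<gamma> s"

end

theory Submission
  imports Defs
begin

text \<open>Fix a parameter \<open>s\<close>. Differentiating the height function gives
  \<open>\<partial>H/\<partial>s = \<langle>t', v\<rangle> = \<langle>k\<^sub>n n\<^sub>\<gamma> + k\<^sub>g n\<^sub>1, v\<rangle>\<close>, so \<open>v\<close> lies in the discriminant set because of \<open>s\<close> exactly
  when \<open>v\<close> is a unit spacelike vector orthogonal to \<open>t\<close> and to \<open>k\<^sub>n n\<^sub>\<gamma> + k\<^sub>g n\<^sub>1\<close>. In the
  pseudo-orthonormal frame \<open>n\<^sub>\<gamma>, t, n\<^sub>1, n\<^sub>2\<close> the vectors orthogonal to these two form the plane spanned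
  by \<open>k\<^sub>g n\<^sub>\<gamma> + k\<^sub>n n\<^sub>1\<close> and \<open>n\<^sub>2\<close>. The first of these has square \<open>k\<^sub>n\<^sup>2 - k\<^sub>g\<^sup>2 > 0\<close>, so the plane is
  spacelike, its unit vectors form a circle, and this circle is the curve
  \<open>\<theta> \<mapsto> DS\<^sub>\<gamma>(s, \<theta>)\<close> (lemma \<open>de_sitter_polar_plane\<close>). The theorem is the union of these pointwise
  statements over \<open>s\<close>.

  Two things have to be established on the way. First, that \<open>n\<^sub>\<gamma>, t, n\<^sub>1\<close> and
  \<open>n\<^sub>2 = n\<^sub>\<gamma> \<and> t \<and> n\<^sub>1\<close> are a pseudo-orthonormal basis. For the first three this is lemma
  \<open>curve_frame\<close>; for \<open>n\<^sub>2\<close> one uses \<open>\<langle>x \<and> y \<and> z, w\<rangle> = det (w, x, y, z)\<close> (lemma \<open>lprod_wedge\<close>)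
  together with the Gram determinant of \<open>w, n\<^sub>\<gamma>, t, n\<^sub>1\<close> (lemma \<open>det_rows4_square\<close>) and the fact
  that nonzero vectors orthogonal to a timelike one are spacelike. Second, that \<open>t\<close> is
  differentiable, which follows from the chain and product rules for \<open>X \<circ> c\<close> (lemma \<open>smooth_composition_derivative\<close>).\<close>

section \<open>The Lorentzian inner product\<close>

lemma UNIV_index_4: "(UNIV :: 4 set) = {0, 1, 2, 3}"
proof -
  have "(4::4) = 0" by simp
  then show ?thesis using UNIV_4 by (metis insert_commute)
qed

lemma sum_index_4: "(\<Sum>i\<in>UNIV. f (i::4)) = f 0 + f 1 + f 2 + (f 3 :: 'a::comm_monoid_add)"
  unfolding UNIV_index_4 by (simp add: ac_simps)

lemma prod_index_4: "(\<Prod>i\<in>UNIV. f (i::4)) = f 0 * f 1 * f 2 * (f 3 :: 'a::comm_monoid_mult)"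
  unfolding UNIV_index_4 by (simp add: ac_simps)

lemma index_4_cases: obtains "(i::4) = 0" | "i = 1" | "i = 2" | "i = 3"
  using UNIV_index_4 by blast

text \<open>Bilinearity yields, through the library interpretation of bounded bilinear maps, both the
  algebraic rules for the product and its Leibniz rule.\<close>

lemma bounded_bilinear_lprod: "bounded_bilinear lprod"
  by (simp flip: bilinear_conv_bounded_bilinear)
     (auto simp: bilinear_def linear_iff lprod_def algebra_simps)

interpretation lprod: bounded_bilinear lprod
  by (rule bounded_bilinear_lprod)

lemma lprod_commute: "lprod x y = lprod y x"
  by (simp add: lprod_def)

text \<open>The Cauchy--Schwarz inequality for the spatial parts gives
  \<open>n\<^sub>0\<^sup>2 w\<^sub>0\<^sup>2 \<le> \<bar>n'\<bar>\<^sup>2 \<bar>w'\<bar>\<^sup>2 = (n\<^sub>0\<^sup>2 - 1) \<bar>w'\<bar>\<^sup>2\<close>, which rearranges to a quantitative form of the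
  positivity of the product on the orthogonal complement of a timelike vector.\<close>

lemma timelike_orthogonal_bound:
  assumes n: "lprod n n = -1" and nw: "lprod n w = 0"
  shows "(w $ 1)\<^sup>2 + (w $ 2)\<^sup>2 + (w $ 3)\<^sup>2 \<le> (n $ 0)\<^sup>2 * lprod w w"
proof -
  have 1: "n $ 0 * w $ 0 = n $ 1 * w $ 1 + n $ 2 * w $ 2 + n $ 3 * w $ 3"
    using nw by (simp add: lprod_def)
  have 2: "(n $ 1)\<^sup>2 + (n $ 2)\<^sup>2 + (n $ 3)\<^sup>2 = (n $ 0)\<^sup>2 - 1"
    using n by (simp add: lprod_def power2_eq_square)
  have "(n $ 0)\<^sup>2 * (w $ 0)\<^sup>2 = (n $ 1 * w $ 1 + n $ 2 * w $ 2 + n $ 3 * w $ 3)\<^sup>2"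
    by (simp flip: 1 add: power_mult_distrib)
  also have "\<dots> \<le> ((n $ 1)\<^sup>2 + (n $ 2)\<^sup>2 + (n $ 3)\<^sup>2) * ((w $ 1)\<^sup>2 + (w $ 2)\<^sup>2 + (w $ 3)\<^sup>2)"
  proof -
    \<comment> \<open>the squared norm of the cross product of the spatial parts (Lagrange's identity)\<close>
    have "0 \<le> (n$1 * w$2 - n$2 * w$1)\<^sup>2 + (n$1 * w$3 - n$3 * w$1)\<^sup>2 + (n$2 * w$3 - n$3 * w$2)\<^sup>2"
      by simp
    then show ?thesis by (simp add: power2_eq_square algebra_simps)
  qed
  also have "\<dots> = ((n $ 0)\<^sup>2 - 1) * ((w $ 1)\<^sup>2 + (w $ 2)\<^sup>2 + (w $ 3)\<^sup>2)"
    by (simp only: 2)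
  finally show ?thesis
    by (simp add: lprod_def power2_eq_square algebra_simps)
qed

lemma vec4_eq_0_iff: "(x :: R41) = 0 \<longleftrightarrow> x $ 0 = 0 \<and> x $ 1 = 0 \<and> x $ 2 = 0 \<and> x $ 3 = 0"
  unfolding vec_eq_iff ball_UNIV[symmetric] UNIV_index_4 by auto

lemma orthogonal_timelike_spacelike:
  assumes n: "lprod n n = -1" and nw: "lprod n w = 0" and w: "w \<noteq> 0"
  shows "spacelike w"
proof -
  let ?q = "(w $ 1)\<^sup>2 + (w $ 2)\<^sup>2 + (w $ 3)\<^sup>2"
  have b: "?q \<le> (n $ 0)\<^sup>2 * lprod w w"
    using timelike_orthogonal_bound[OF n nw] .
  have "(n $ 0)\<^sup>2 = 1 + ((n $ 1)\<^sup>2 + (n $ 2)\<^sup>2 + (n $ 3)\<^sup>2)"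
    using n by (simp add: lprod_def power2_eq_square)
  then have n0: "n $ 0 \<noteq> 0"
    by (auto simp: add_nonneg_eq_0_iff)
  have "lprod w w > 0"
  proof (rule ccontr)
    assume "\<not> lprod w w > 0"
    then have "(n $ 0)\<^sup>2 * lprod w w \<le> 0"
      by (simp add: mult_nonneg_nonpos)
    with b have "?q \<le> 0" by linarith
    moreover have "(w $ 1)\<^sup>2 \<ge> 0" "(w $ 2)\<^sup>2 \<ge> 0" "(w $ 3)\<^sup>2 \<ge> 0"
      by simp_all
    ultimately have "(w $ 1)\<^sup>2 = 0" "(w $ 2)\<^sup>2 = 0" "(w $ 3)\<^sup>2 = 0"
      by linarith+
    then have q0: "w $ 1 = 0" "w $ 2 = 0" "w $ 3 = 0"
      by simp_all
    with nw n0 have "w $ 0 = 0"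
      by (simp add: lprod_def)
    with q0 w show False
      by (simp add: vec4_eq_0_iff)
  qed
  with w show ?thesis
    by (simp add: spacelike_def)
qed

section \<open>The wedge product and pseudo-orthonormal frames\<close>

definition rows4 :: "R41 \<Rightarrow> R41 \<Rightarrow> R41 \<Rightarrow> R41 \<Rightarrow> real ^ 4 ^ 4" where
  "rows4 w x y z = (\<chi> r. if r = 0 then w else if r = 1 then x else if r = 2 then y else z)"

lemma rows4_nth [simp]:
  "rows4 w x y z $ 0 = w" "rows4 w x y z $ 1 = x" "rows4 w x y z $ 2 = y" "rows4 w x y z $ 3 = z"
  by (simp_all add: rows4_def)

lemma det_row_expansion:
  fixes w :: "'a::comm_ring_1 ^ 'n" and c :: "'n \<Rightarrow> 'a ^ 'n"
  shows "det (\<chi> r. if r = k then w else c r)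
       = (\<Sum>i\<in>UNIV. w $ i * det (\<chi> r. if r = k then axis i 1 else c r))"
proof -
  have "det (\<chi> r. if r = k then (\<Sum>i\<in>UNIV. w $ i *s axis i 1) else c r)
      = (\<Sum>i\<in>UNIV. det (\<chi> r. if r = k then w $ i *s axis i 1 else c r))"
    by (rule det_linear_row_sum[OF finite_class.finite_UNIV,
          of k "\<lambda>_ i. w $ i *s axis i 1" "\<lambda>r. c r"])
  also have "\<dots> = (\<Sum>i\<in>UNIV. w $ i * det (\<chi> r. if r = k then axis i 1 else c r))"
  proof (rule sum.cong[OF refl])
    fix i
    show "det (\<chi> r. if r = k then w $ i *s axis i 1 else c r)
        = w $ i * det (\<chi> r. if r = k then axis i 1 else c r)"
      by (rule det_row_mul[of k "w $ i" "\<lambda>_. axis i 1" "\<lambda>r. c r"])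
  qed
  finally show ?thesis
    by (simp only: basis_expansion)
qed

text \<open>The sign of \<open>-e\<^sub>0\<close> in the formal determinant cancels the sign of the time component in the
  product, so pairing with \<open>w\<close> just replaces the formal first row by \<open>w\<close>.\<close>

lemma lprod_wedge: "lprod (wedge x y z) w = det (rows4 w x y z)"
proof -
  let ?c = "\<lambda>r :: 4. if r = 1 then x else if r = 2 then y else z"
  have "det (rows4 w x y z)
      = (\<Sum>i\<in>UNIV. w $ i * det (\<chi> r. if r = 0 then axis i 1 else ?c r))"
    unfolding rows4_def by (rule det_row_expansion)
  also have "\<dots> = (\<Sum>i\<in>UNIV. w $ i * ((if i = 0 then -1 else 1) * wedge x y z $ i))"
  proof (rule sum.cong[OF refl])
    fix i :: 4
    let ?e = "if i = 0 then -1 else 1 :: real"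
    have "axis i ?e = ?e *s axis i 1"
      by (simp add: vec_eq_iff axis_def)
    then have "wedge x y z $ i = det (\<chi> r. if r = 0 then ?e *s axis i 1 else ?c r)"
      by (simp only: wedge_def vec_lambda_beta)
    also have "\<dots> = ?e * det (\<chi> r. if r = 0 then axis i 1 else ?c r)"
      by (rule det_row_mul[of 0 ?e "\<lambda>_. axis i 1" ?c])
    finally show "w $ i * det (\<chi> r. if r = 0 then axis i 1 else ?c r)
        = w $ i * (?e * wedge x y z $ i)"
      by simp
  qed
  also have "\<dots> = lprod (wedge x y z) w"
    by (simp add: sum_index_4 lprod_def)
  finally show ?thesis ..
qed

lemma lprod_wedge_orthogonal:
  "lprod (wedge x y z) x = 0" "lprod (wedge x y z) y = 0" "lprod (wedge x y z) z = 0"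
proof -
  show "lprod (wedge x y z) x = 0"
    unfolding lprod_wedge by (rule det_identical_rows[of 0 1]) (simp_all add: row_def)
  show "lprod (wedge x y z) y = 0"
    unfolding lprod_wedge by (rule det_identical_rows[of 0 2]) (simp_all add: row_def)
  show "lprod (wedge x y z) z = 0"
    unfolding lprod_wedge by (rule det_identical_rows[of 0 3]) (simp_all add: row_def)
qed

definition orthonormal_triple :: "R41 \<Rightarrow> R41 \<Rightarrow> R41 \<Rightarrow> bool" where
  "orthonormal_triple n t m \<longleftrightarrow>
     lprod n n = -1 \<and> lprod t t = 1 \<and> lprod m m = 1 \<and>
     lprod n t = 0 \<and> lprod n m = 0 \<and> lprod t m = 0"

text \<open>Write \<open>A\<close> for the matrix with rows \<open>w, n, t, m\<close> and \<open>J = diag(-1, 1, 1, 1)\<close>. Then \<open>A J A\<^sup>T\<close>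
  is the Gram matrix \<open>diag(\<langle>w, w\<rangle>, -1, 1, 1)\<close>; comparing determinants gives the identity.\<close>

lemma det_rows4_square:
  assumes T: "orthonormal_triple n t m"
    and w: "lprod n w = 0" "lprod t w = 0" "lprod m w = 0"
  shows "(det (rows4 w n t m))\<^sup>2 = lprod w w"
proof -
  let ?A = "rows4 w n t m"
  let ?J = "\<chi> i j. if i = j then (if i = 0 then -1 else 1) else 0 :: real^4^4"
  have "(?A ** ?J ** transpose ?A) $ i $ j = lprod (?A $ i) (?A $ j)" for i j
    by (simp add: matrix_matrix_mult_def transpose_def sum_index_4 lprod_def)
  then have G: "?A ** ?J ** transpose ?A = (\<chi> i j. lprod (?A $ i) (?A $ j))"
    by (simp add: vec_eq_iff)
  have dJ: "det ?J = -1"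
    by (subst det_diagonal) (simp_all add: prod_index_4)
  have "det (\<chi> i j. lprod (?A $ i) (?A $ j)) = (\<Prod>i\<in>UNIV. lprod (?A $ i) (?A $ i))"
  proof (subst det_diagonal)
    fix i j :: 4
    assume "i \<noteq> j"
    then show "(\<chi> i j. lprod (?A $ i) (?A $ j)) $ i $ j = 0"
      using T w
      by (cases rule: index_4_cases[of i]; cases rule: index_4_cases[of j])
         (simp_all add: orthonormal_triple_def lprod_commute)
  qed simp
  also have "\<dots> = - lprod w w"
    using T by (simp add: prod_index_4 orthonormal_triple_def)
  finally have "det ?A * det ?J * det ?A = - lprod w w"
    by (simp flip: G add: det_mul det_transpose)
  then show ?thesis
    by (simp add: dJ power2_eq_square)
qed

text \<open>The three conditions are Euclidean orthogonality to three vectors, obtained by flipping the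
  sign of the time components, and three vectors cannot span a space of dimension 4.\<close>

lemma exists_orthogonal:
  "\<exists>w. w \<noteq> 0 \<and> lprod x w = 0 \<and> lprod y w = 0 \<and> lprod z w = 0"
proof -
  let ?J = "\<lambda>x :: R41. \<chi> i. (if i = 0 then - (x $ i) else x $ i)"
  have J: "lprod a w = ?J a \<bullet> w" for a w
    by (simp add: inner_vec_def sum_index_4 lprod_def)
  have "dim {?J x, ?J y, ?J z} \<le> card {?J x, ?J y, ?J z}"
    by (rule dim_le_card') simp
  also have "\<dots> \<le> 3"
    by (simp add: card_insert_if)
  finally have "dim {?J x, ?J y, ?J z} < DIM(R41)"
    by simp
  then obtain w where "w \<noteq> 0" and o: "\<And>a. a \<in> span {?J x, ?J y, ?J z} \<Longrightarrow> orthogonal w a"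
    using orthogonal_to_subspace_exists by blast
  then show ?thesis
    unfolding J by (intro exI[of _ w])
      (simp add: o[unfolded orthogonal_def, OF span_base] inner_commute[of _ w])
qed

text \<open>Applied to \<open>w = N = n \<and> t \<and> m\<close>, where the determinant is \<open>\<langle>N, N\<rangle>\<close> itself, the Gram identity
  says \<open>\<langle>N, N\<rangle>\<^sup>2 = \<langle>N, N\<rangle>\<close>. To exclude the value \<open>0\<close>, it is applied to some other nonzero \<open>w\<close>
  orthogonal to the triple: \<open>w\<close> is spacelike, so \<open>\<langle>N, w\<rangle> \<noteq> 0\<close> and \<open>N\<close> is a nonzero vector
  orthogonal to the timelike \<open>n\<close>.\<close>

lemma lprod_wedge_self:
  assumes T: "orthonormal_triple n t m"
  shows "lprod (wedge n t m) (wedge n t m) = 1"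
proof -
  let ?N = "wedge n t m"
  have n: "lprod n n = -1" using T by (simp add: orthonormal_triple_def)
  obtain w where w: "w \<noteq> 0" "lprod n w = 0" "lprod t w = 0" "lprod m w = 0"
    using exists_orthogonal by blast
  have "lprod w w > 0"
    using orthogonal_timelike_spacelike[OF n w(2,1)] by (simp add: spacelike_def)
  then have "lprod ?N w \<noteq> 0"
    using det_rows4_square[OF T w(2-4)] by (auto simp: lprod_wedge)
  then have "?N \<noteq> 0" by (auto simp: lprod.zero_left)
  moreover have ort: "lprod n ?N = 0" "lprod t ?N = 0" "lprod m ?N = 0"
    by (simp_all add: lprod_wedge_orthogonal lprod_commute[of _ ?N])
  ultimately have pos: "lprod ?N ?N > 0"
    using orthogonal_timelike_spacelike[OF n] by (simp add: spacelike_def)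
  have "(lprod ?N ?N)\<^sup>2 = lprod ?N ?N"
    using det_rows4_square[OF T ort] by (simp add: lprod_wedge)
  with pos show ?thesis by (simp add: power2_eq_square)
qed

lemmas lprod_linear = lprod.add_left lprod.add_right lprod.diff_left lprod.diff_right
  lprod.scaleR_left lprod.scaleR_right

lemma orthonormal_frame_products:
  assumes "orthonormal_triple n t m"
  defines "N \<equiv> wedge n t m"
  shows "lprod n n = -1" "lprod n t = 0" "lprod n m = 0" "lprod n N = 0"
    and "lprod t n = 0" "lprod t t = 1" "lprod t m = 0" "lprod t N = 0"
    and "lprod m n = 0" "lprod m t = 0" "lprod m m = 1" "lprod m N = 0"
    and "lprod N n = 0" "lprod N t = 0" "lprod N m = 0" "lprod N N = 1"
proof -
  show T: "lprod n n = -1" "lprod n t = 0" "lprod n m = 0" "lprod t t = 1" "lprod t m = 0" "lprod m m = 1"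
    using assms(1) by (simp_all add: orthonormal_triple_def)
  then show "lprod t n = 0" "lprod m n = 0" "lprod m t = 0"
    by (simp_all only: lprod_commute[of t n] lprod_commute[of m n] lprod_commute[of m t])
  show N: "lprod N n = 0" "lprod N t = 0" "lprod N m = 0" "lprod N N = 1"
    using assms(1) by (simp_all add: N_def lprod_wedge_self lprod_wedge_orthogonal)
  then show "lprod n N = 0" "lprod t N = 0" "lprod m N = 0"
    by (simp_all only: lprod_commute[of n N] lprod_commute[of t N] lprod_commute[of m N])
qed

text \<open>The difference \<open>r\<close> of the two sides is orthogonal to all four frame vectors. In particular
  \<open>det (r, n, t, m) = \<langle>n \<and> t \<and> m, r\<rangle> = 0\<close>, so \<open>\<langle>r, r\<rangle> = 0\<close> by the Gram identity; being orthogonal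
  to the timelike \<open>n\<close>, \<open>r\<close> must vanish.\<close>

lemma frame_expansion:
  assumes T: "orthonormal_triple n t m"
  shows "v = (- lprod n v) *\<^sub>R n + lprod t v *\<^sub>R t + lprod m v *\<^sub>R m
             + lprod (wedge n t m) v *\<^sub>R wedge n t m"
    (is "v = ?p")
proof (rule ccontr)
  assume "v \<noteq> ?p"
  then have nz: "v - ?p \<noteq> 0" by simp
  let ?N = "wedge n t m"
  note products = orthonormal_frame_products[OF T]
  have r: "lprod n (v - ?p) = 0" "lprod t (v - ?p) = 0" "lprod m (v - ?p) = 0"
    "lprod ?N (v - ?p) = 0"
    by (simp_all add: lprod_linear products)
  have "lprod (v - ?p) (v - ?p) = 0"
    using det_rows4_square[OF T r(1-3)] r(4) by (simp add: lprod_wedge)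
  with orthogonal_timelike_spacelike[OF products(1) r(1) nz] show False
    by (simp add: spacelike_def)
qed

text \<open>The plane orthogonal to \<open>t\<close> and \<open>b n + a m\<close> is spanned by \<open>a n + b m\<close> (orthogonal to
  \<open>b n + a m\<close> because \<open>n\<close> and \<open>m\<close> have squares of opposite sign) and \<open>n \<and> t \<and> m\<close>. These two are
  orthogonal with squares \<open>b\<^sup>2 - a\<^sup>2 > 0\<close> and \<open>1\<close>, so the plane meets de Sitter space in a circle.\<close>

lemma de_sitter_polar_plane:
  assumes T: "orthonormal_triple n t m" and a: "a\<^sup>2 < b\<^sup>2"
  shows "v \<in> de_sitter \<and> lprod t v = 0 \<and> lprod (b *\<^sub>R n + a *\<^sub>R m) v = 0 \<longleftrightarrow>
    (\<exists>\<theta>\<in>{0..2 * pi}. v = (cos \<theta> / sqrt (b\<^sup>2 - a\<^sup>2)) *\<^sub>R (a *\<^sub>R n + b *\<^sub>R m)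
                         + sin \<theta> *\<^sub>R wedge n t m)"
    (is "?L \<longleftrightarrow> ?R")
proof
  let ?N = "wedge n t m"
  note rules = lprod_linear orthonormal_frame_products[OF T]
  let ?r = "sqrt (b\<^sup>2 - a\<^sup>2)"
  have r: "?r \<noteq> 0" "?r\<^sup>2 = b\<^sup>2 - a\<^sup>2" using a by simp_all
  have norm: "lprod (x *\<^sub>R (a *\<^sub>R n + b *\<^sub>R m) + y *\<^sub>R ?N) (x *\<^sub>R (a *\<^sub>R n + b *\<^sub>R m) + y *\<^sub>R ?N)
      = (x * ?r)\<^sup>2 + y\<^sup>2" for x y
    by (simp add: rules r power_mult_distrib) (simp add: power2_eq_square algebra_simps)
  {
    assume ?R
    then obtain \<theta> where v: "v = (cos \<theta> / ?r) *\<^sub>R (a *\<^sub>R n + b *\<^sub>R m) + sin \<theta> *\<^sub>R ?N"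
      by blast
    have "lprod v v = 1"
      unfolding v norm using r by simp
    then show ?L
      by (simp add: de_sitter_def) (simp add: v rules)
  next
    assume L: ?L
    have b: "b \<noteq> 0" using a by (auto simp: not_less)
    \<comment> \<open>orthogonality to \<open>b n + a m\<close> makes the \<open>n\<close>, \<open>m\<close> coordinates of \<open>v\<close> proportional to \<open>(a, b)\<close>, with factor \<open>x\<close>\<close>
    define x where "x = lprod m v / b"
    have "b * lprod n v = - (a * lprod m v)"
      using L by (simp add: lprod_linear)
    then have "- lprod n v = x * a" "lprod m v = x * b"
      using b by (simp_all add: x_def field_simps)
    with frame_expansion[OF T, of v] L
    have v: "v = x *\<^sub>R (a *\<^sub>R n + b *\<^sub>R m) + lprod ?N v *\<^sub>R ?N"
      by (simp add: scaleR_add_right)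
    have "lprod v v = 1" using L by (simp add: de_sitter_def)
    then have "(x * ?r)\<^sup>2 + (lprod ?N v)\<^sup>2 = 1"
      using norm[of x "lprod ?N v"] v by metis
    then obtain \<theta> where \<theta>: "0 \<le> \<theta>" "\<theta> \<le> 2 * pi" "x * ?r = cos \<theta>" "lprod ?N v = sin \<theta>"
      by (rule sincos_total_2pi_le[THEN exE]) auto
    then have "x = cos \<theta> / ?r" using r(1) by (simp add: field_simps)
    with v \<theta> show ?R by auto
  }
qed

section \<open>The frame along the curve\<close>

lemma smooth_on_differentiable:
  assumes "smooth_on S f" "x \<in> S"
  shows "f differentiable (at x)"
    and "(\<lambda>x. frechet_derivative f (at x) v) differentiable (at x)"
proof -
  have "C_k_on (Suc (Suc 0)) S f" using assms(1) unfolding smooth_on_def by blast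
  then show "f differentiable (at x)" "(\<lambda>x. frechet_derivative f (at x) v) differentiable (at x)"
    using assms(2) by simp_all
qed

lemma frechet_derivative_eq_vector_derivative:
  assumes "f differentiable (at (s::real))"
  shows "frechet_derivative f (at s) = (\<lambda>h. h *\<^sub>R vector_derivative f (at s))"
  using assms vector_derivative_works has_vector_derivative_def frechet_derivative_at by metis

lemma differentiable_cong_open:
  assumes "f differentiable (at s)" "open I" "s \<in> I" "\<And>r. r \<in> I \<Longrightarrow> f r = g r"
  shows "g differentiable (at s)"
  using assms has_derivative_transform_within_open unfolding differentiable_def by metis

text \<open>Smoothness is formulated by means of the maps \<open>u \<mapsto> DX(u) b\<close> with a fixed direction \<open>b\<close>,
  whereas in the velocity \<open>DX(c(s)) c'(s)\<close> the direction varies with \<open>s\<close>. Expanding \<open>c'(s)\<close> in the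
  standard basis turns the velocity into a finite sum of products of differentiable functions.\<close>

lemma smooth_composition_derivative:
  fixes X :: "'a::euclidean_space \<Rightarrow> 'b::real_normed_vector" and c :: "real \<Rightarrow> 'a"
  assumes X: "smooth_on U X" and c: "smooth_on I c" and cU: "c ` I \<subseteq> U"
    and I: "open I" and s: "s \<in> I"
  shows "((\<lambda>s. X (c s)) has_vector_derivative
           frechet_derivative X (at (c s)) (vector_derivative c (at s))) (at s)"
    and "(\<lambda>s. frechet_derivative X (at (c s)) (vector_derivative c (at s))) differentiable (at s)"
proof -
  have DX: "(X has_derivative frechet_derivative X (at (c r))) (at (c r))" if "r \<in> I" for r
    using smooth_on_differentiable(1)[OF X] cU that frechet_derivative_works by blast
  have dc: "c differentiable (at r)" if "r \<in> I" for r
    using smooth_on_differentiable(1)[OF c that] .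
  have lin: "linear (frechet_derivative X (at (c r)))" if "r \<in> I" for r
    using DX[OF that] has_derivative_linear by blast
  have Dc: "(c has_derivative (\<lambda>h. h *\<^sub>R vector_derivative c (at s))) (at s)"
    using dc[OF s] vector_derivative_works has_vector_derivative_def by metis
  show "((\<lambda>s. X (c s)) has_vector_derivative
           frechet_derivative X (at (c s)) (vector_derivative c (at s))) (at s)"
    using diff_chain_at[OF Dc DX[OF s]]
    by (simp add: has_vector_derivative_def o_def linear_scale[OF lin[OF s]])
  let ?f = "\<lambda>r. \<Sum>b\<in>Basis. (frechet_derivative c (at r) 1 \<bullet> b) *\<^sub>R frechet_derivative X (at (c r)) b"
  have eq: "?f r = frechet_derivative X (at (c r)) (vector_derivative c (at r))" if r: "r \<in> I" for r
  proof -
    have "frechet_derivative X (at (c r)) (vector_derivative c (at r))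
        = frechet_derivative X (at (c r)) (\<Sum>b\<in>Basis. (vector_derivative c (at r) \<bullet> b) *\<^sub>R b)"
      by (simp add: euclidean_representation)
    then show ?thesis
      by (simp only: linear_sum[OF lin[OF r]] linear_scale[OF lin[OF r]])
         (simp add: frechet_derivative_eq_vector_derivative[OF dc[OF r]])
  qed
  have "(\<lambda>r. frechet_derivative X (at (c r)) b) differentiable (at s)" for b
    using differentiable_chain_at[OF dc[OF s], of "\<lambda>u. frechet_derivative X (at u) b"]
      smooth_on_differentiable(2)[OF X] cU s by (auto simp: o_def)
  moreover have "(\<lambda>r. frechet_derivative c (at r) 1 \<bullet> b) differentiable (at s)" for b
    using smooth_on_differentiable(2)[OF c s] by (intro differentiable_inner) auto
  ultimately have "?f differentiable (at s)"
    by (intro differentiable_sum ballI differentiable_scaleR) auto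
  then show "(\<lambda>s. frechet_derivative X (at (c s)) (vector_derivative c (at s))) differentiable (at s)"
    by (rule differentiable_cong_open[OF _ I s eq])
qed

text \<open>The vector \<open>t\<close> is spacelike because it is tangent to the hypersurface, so \<open>\<langle>t, t\<rangle> = 1\<close> and
  \<open>\<langle>t, t'\<rangle> = 0\<close>. By the definition of \<open>k\<^sub>n\<close>, the vector \<open>t' - k\<^sub>n n\<^sub>\<gamma>\<close> is orthogonal to the timelike
  \<open>n\<^sub>\<gamma>\<close>; it is nonzero since \<open>k\<^sub>g \<noteq> 0\<close>, hence spacelike, so the absolute value in its Lorentzian
  norm \<open>k\<^sub>g\<close> can be dropped and dividing by \<open>k\<^sub>g\<close> makes its square \<open>+1\<close>.\<close>

lemma curve_frame:
  assumes X: "spacelike_hypersurface X U" and n: "future_unit_normal X U n"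
    and I: "open I" and c: "regular_curve I U c" and \<gamma>: "\<And>s. s \<in> I \<Longrightarrow> \<gamma> s = X (c s)"
    and unit: "unit_speed I \<gamma>" and s: "s \<in> I" and kg: "k_g n \<gamma> s \<noteq> 0"
  shows "(tang \<gamma> has_vector_derivative tang' \<gamma> s) (at s)"
    and "orthonormal_triple (n_curve n \<gamma> s) (tang \<gamma> s) (n_1 n \<gamma> s)"
    and "tang' \<gamma> s = k_n n \<gamma> s *\<^sub>R n_curve n \<gamma> s + k_g n \<gamma> s *\<^sub>R n_1 n \<gamma> s"
proof -
  have XU: "smooth_on U X" and cI: "smooth_on I c" and cU: "c ` I \<subseteq> U"
    using X c by (simp_all add: spacelike_hypersurface_def smooth_embedding_def regular_curve_def)
  note comp = smooth_composition_derivative[OF XU cI cU I]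
  let ?t = "\<lambda>r. frechet_derivative X (at (c r)) (vector_derivative c (at r))"
  have tang_eq: "tang \<gamma> r = ?t r" if r: "r \<in> I" for r
    using has_vector_derivative_transform_within_open[OF comp(1)[OF r] I r] \<gamma>
    by (simp add: tang_def vector_derivative_at)
  have "tang \<gamma> differentiable (at s)"
    by (rule differentiable_cong_open[OF comp(2)[OF s] I s]) (simp add: tang_eq)
  then show D: "(tang \<gamma> has_vector_derivative tang' \<gamma> s) (at s)"
    by (simp add: tang'_def vector_derivative_works)
  have t_in: "tang \<gamma> r \<in> tangent_space X (c r)" if "r \<in> I" for r
    using tang_eq[OF that] by (simp add: tangent_space_def)
  have tt: "lprod (tang \<gamma> r) (tang \<gamma> r) = 1" if r: "r \<in> I" for r
  proof -
    have abs1: "\<bar>lprod (tang \<gamma> r) (tang \<gamma> r)\<bar> = 1"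
      using unit r by (simp add: unit_speed_def lnorm_def tang_def)
    then have "tang \<gamma> r \<noteq> 0" by (auto simp: lprod.zero_left)
    then have "spacelike (tang \<gamma> r)"
      using X t_in[OF r] cU r by (auto simp: spacelike_hypersurface_def)
    with abs1 show ?thesis by (simp add: spacelike_def)
  qed
  have "((\<lambda>r. lprod (tang \<gamma> r) (tang \<gamma> r)) has_vector_derivative
          lprod (tang \<gamma> s) (tang' \<gamma> s) + lprod (tang' \<gamma> s) (tang \<gamma> s)) (at s)"
    by (rule lprod.has_vector_derivative[OF D D])
  then have "((\<lambda>r. 1) has_vector_derivative
          lprod (tang \<gamma> s) (tang' \<gamma> s) + lprod (tang' \<gamma> s) (tang \<gamma> s)) (at s)"
    by (rule has_vector_derivative_transform_within_open[OF _ I s]) (simp add: tt)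
  then have tt': "lprod (tang \<gamma> s) (tang' \<gamma> s) = 0"
    using vector_derivative_unique_at[OF _ has_vector_derivative_const]
      lprod_commute[of "tang' \<gamma> s"] by fastforce
  have nn: "lprod (n_curve n \<gamma> s) (n_curve n \<gamma> s) = -1"
    and nt: "lprod (n_curve n \<gamma> s) (tang \<gamma> s) = 0"
    using n s cU t_in[OF s] by (auto simp: future_unit_normal_def n_curve_def \<gamma>[OF s])
  let ?w = "tang' \<gamma> s - k_n n \<gamma> s *\<^sub>R n_curve n \<gamma> s"
  have nw: "lprod (n_curve n \<gamma> s) ?w = 0"
    by (simp add: lprod_linear nn) (simp add: k_n_def)
  have tw: "lprod (tang \<gamma> s) ?w = 0"
    using nt by (simp add: lprod_linear tt' lprod_commute)
  have "?w \<noteq> 0"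
    using kg by (auto simp: k_g_def lnorm_def lprod.zero_left)
  then have "lprod ?w ?w > 0"
    using orthogonal_timelike_spacelike[OF nn nw] by (simp add: spacelike_def)
  then have "lprod ?w ?w = (k_g n \<gamma> s)\<^sup>2"
    by (simp add: k_g_def lnorm_def)
  then have "lprod (n_1 n \<gamma> s) (n_1 n \<gamma> s) = 1"
    using kg by (simp add: n_1_def lprod.scaleR_left lprod.scaleR_right power2_eq_square)
  then show "orthonormal_triple (n_curve n \<gamma> s) (tang \<gamma> s) (n_1 n \<gamma> s)"
    using nn nt nw tw tt[OF s]
    by (simp add: orthonormal_triple_def n_1_def lprod.scaleR_right)
  show "tang' \<gamma> s = k_n n \<gamma> s *\<^sub>R n_curve n \<gamma> s + k_g n \<gamma> s *\<^sub>R n_1 n \<gamma> s"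
    using kg by (simp add: n_1_def)
qed

section \<open>The discriminant set of the tangential height functions\<close>

theorem corollary5p2:
  fixes X :: "real ^ 3 \<Rightarrow> R41" and U :: "(real ^ 3) set" and n :: "R41 \<Rightarrow> R41"
    and I :: "real set" and \<gamma>bar :: "real \<Rightarrow> real ^ 3" and \<gamma> :: "real \<Rightarrow> R41"
  assumes "spacelike_hypersurface X U"
    and "future_unit_normal X U n"
    and "open I" and "is_interval I"
    and "regular_curve I U \<gamma>bar"
    and "\<And>s. s \<in> I \<Longrightarrow> \<gamma> s = X (\<gamma>bar s)"
    and "unit_speed I \<gamma>"
    and "\<And>s. s \<in> I \<Longrightarrow> k_g n \<gamma> s \<noteq> 0"
    and "\<And>s. s \<in> I \<Longrightarrow> k_n n \<gamma> s * tau_2 n \<gamma> s + k_g n \<gamma> s * tau_g n \<gamma> s \<noteq> 0"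
    and "\<And>s. s \<in> I \<Longrightarrow> (k_n n \<gamma> s)\<^sup>2 > (k_g n \<gamma> s)\<^sup>2"
  shows "(\<lambda>(s, \<theta>). DS n \<gamma> s \<theta>) ` (I \<times> {0..2 * pi})
         = discriminant_set I de_sitter (height_St \<gamma>)"
proof -
  have slice: "v \<in> de_sitter \<and> height_St \<gamma> s v = 0 \<and> deriv (\<lambda>s. height_St \<gamma> s v) s = 0
      \<longleftrightarrow> (\<exists>\<theta>\<in>{0..2 * pi}. v = DS n \<gamma> s \<theta>)" if s: "s \<in> I" for s v
  proof -
    note frame = curve_frame[OF assms(1-3,5-7) s assms(8)[OF s]]
    have "((\<lambda>s. lprod (tang \<gamma> s) v) has_vector_derivative
        lprod (tang \<gamma> s) 0 + lprod (tang' \<gamma> s) v) (at s)"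
      by (rule lprod.has_vector_derivative[OF frame(1) has_vector_derivative_const])
    then have "deriv (\<lambda>s. height_St \<gamma> s v) s = lprod (tang' \<gamma> s) v"
      unfolding height_St_def
      by (intro DERIV_imp_deriv)
         (simp add: has_real_derivative_iff_has_vector_derivative lprod.zero_right)
    then show ?thesis
      using de_sitter_polar_plane[OF frame(2) assms(10)[OF s], of v]
      by (simp add: frame(3) height_St_def DS_def n_2_def)
  qed
  show ?thesis
    unfolding discriminant_set_def using slice by (auto simp: image_iff) blast+
qed

end
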